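(* Let $F$ be a field, let $r<n$ be positive integers with $n<2r$, and let $U,V$ be $n\times n$ matrices over $F$ with $UV=I_n$. Denote the rows of $U$, in order, by $e_0,\ldots,e_{n-1}$ and the columns of $V$, in order, by $f_0,\ldots,f_{n-1}$. Assume that for every $k$ with $1\le k\le n$, any $k$ successive rows $e_i,e_{i+1},\ldots,e_{i+k-1}$ of $U$ generate an mds linear code, i.e. an $(n,k)$ linear code of minimum distance $n-k+1$. Define the $r\times n$ polynomial matrix $$A[z]=\begin{pmatrix} e_0\\ e_1\\ \vdots\\ e_{r-1}\end{pmatrix}+\begin{pmatrix} e_r\\ \vdots\\ e_{n-1}\\ 0\\ \vdots\\ 0\end{pmatrix}z ,$$ where $2r-n$ zero rows are appended below $e_{n-1}$ in the coefficient of $z$. Then: (1) $A[z]$ is a noncatastrophic generator matrix of a convolutional code $\mathcal C$ of rate $\frac rn$, memory $1$ and degree $n-r$. (2) $H[z]=(f_r,f_{r+1},\ldots,f_{n-1})-(f_0,f_1,\ldots,f_{n-r-1})z$ is a control matrix of $\mathcal C$. (3) The free distance of $\mathcal C$ is $2(n-r)+1$, which is the maximum free distance attainable for these parameters, i.e. it equals $(n-r)\left(\lfloor \delta/r\rfloor+1\right)+\delta+1$ with $\delta=n-r$. (4) $\mathcal C$ corrects up to $t=\lfloor\frac{n-r}{2}\rfloor$ errors at each component of the error vector: an error vector $E[z]=\sum_i \alpha_i z^i$ with $\alpha_i\in F^n$, in which each $\alpha_i$ has at most $t$ non-zero entries, is determined by $E[z]H[z]$.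
   Context: A convolutional code of length $n$ and rank $r$ over $F$ is the $F[z]$-submodule $\{u(z)G[z]: u(z)\in F[z]^r\}$ of $F[z]^n$ for a generator matrix $G[z]\in F[z]^{r\times n}$ of rank $r$; its rate is $r/n$. The row degree $\delta_i$ is the maximal degree of the entries in row $i$ of $G[z]$, the degree is $\delta=\sum_i\delta_i$ and the memory is $\mu=\max_i\delta_i$. $G[z]$ is noncatastrophic if it has a polynomial right inverse, i.e. an $n\times r$ polynomial matrix $K[z]$ of rank $r$ with $G[z]K[z]=I_r$. A control (check) matrix of a code $\mathcal C$ of rank $r$ is an $n\times(n-r)$ polynomial matrix $H[z]$ with $\mathcal C=\{v\in F[z]^n : vH[z]=0\}$. The weight (distance) of $v(z)=\sum_i v_iz^i$ with $v_i\in F^n$ is the sum over $i$ of the numbers of non-zero entries of $v_i$; the free distance is the minimum weight of a non-zero codeword. *)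

theory Defs
  imports
    "Jordan_Normal_Form.DL_Rank"
    "HOL-Computational_Algebra.Polynomial_Factorial"
begin

text \<open>Codewords and messages are row vectors: \<open>row_mult u A\<close> is the product \<open>u A\<close>.\<close>

definition row_mult :: "'a :: comm_semiring_0 vec \<Rightarrow> 'a mat \<Rightarrow> 'a vec" where
  "row_mult u A = transpose_mat A *\<^sub>v u"

subsection \<open>Linear block codes\<close>

definition hamming_dist :: "'a vec \<Rightarrow> 'a vec \<Rightarrow> nat" where
  "hamming_dist v w = card {i. i < dim_vec v \<and> v $ i \<noteq> w $ i}"

definition hamming_weight :: "'a :: zero vec \<Rightarrow> nat" where
  "hamming_weight v = card {i. i < dim_vec v \<and> v $ i \<noteq> 0}"

definition min_distance :: "'a vec set \<Rightarrow> nat" where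
  "min_distance C = Inf {hamming_dist v w | v w. v \<in> C \<and> w \<in> C \<and> v \<noteq> w}"

definition linear_code :: "nat \<Rightarrow> nat \<Rightarrow> 'a :: field vec set \<Rightarrow> bool" where
  "linear_code n k C \<longleftrightarrow>
     subspace class_ring C (module_vec TYPE('a) n) \<and>
     vectorspace.dim class_ring (module_vec TYPE('a) n \<lparr>carrier := C\<rparr>) = k"

definition mds_code :: "nat \<Rightarrow> nat \<Rightarrow> 'a :: field vec set \<Rightarrow> bool" where
  "mds_code n k C \<longleftrightarrow> linear_code n k C \<and> min_distance C = n - k + 1"

text \<open>The subspace of \<open>F\<^sup>n\<close> generated by the rows \<open>i, \<dots>, i + k - 1\<close> of \<open>U\<close>.\<close>

definition rows_code :: "nat \<Rightarrow> 'a :: field mat \<Rightarrow> nat \<Rightarrow> nat \<Rightarrow> 'a vec set" where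
  "rows_code n U i k =
     LinearCombinations.module.span class_ring (module_vec TYPE('a) n) (row U ` {i..<i + k})"

subsection \<open>Polynomial matrices and convolutional codes\<close>

abbreviation const_mat :: "'a :: zero mat \<Rightarrow> 'a poly mat" where
  "const_mat \<equiv> map_mat (\<lambda>c. [:c:])"

text \<open>The rank of a polynomial matrix is its rank over the field \<open>F(z)\<close>. The first argument of
  \<^const>\<open>vec_space.rank\<close> is the number of rows.\<close>

definition poly_rank :: "'a :: field poly mat \<Rightarrow> nat" where
  "poly_rank G = vec_space.rank (dim_row G) (map_mat to_fract G)"

definition generator_matrix :: "nat \<Rightarrow> nat \<Rightarrow> 'a :: field poly mat \<Rightarrow> bool" where
  "generator_matrix n r G \<longleftrightarrow> G \<in> carrier_mat r n \<and> poly_rank G = r"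

definition conv_code :: "'a :: field poly mat \<Rightarrow> 'a poly vec set" where
  "conv_code G = {row_mult u G | u. u \<in> carrier_vec (dim_row G)}"

definition conv_rate :: "'a :: field poly mat \<Rightarrow> rat" where
  "conv_rate G = of_nat (dim_row G) / of_nat (dim_col G)"

definition row_degree :: "'a :: field poly mat \<Rightarrow> nat \<Rightarrow> nat" where
  "row_degree G i = Max ((\<lambda>j. degree (G $$ (i, j))) ` {..<dim_col G})"

definition conv_degree :: "'a :: field poly mat \<Rightarrow> nat" where
  "conv_degree G = (\<Sum>i<dim_row G. row_degree G i)"

definition conv_memory :: "'a :: field poly mat \<Rightarrow> nat" where
  "conv_memory G = Max (row_degree G ` {..<dim_row G})"

definition noncatastrophic :: "'a :: field poly mat \<Rightarrow> bool" where
  "noncatastrophic G \<longleftrightarrow>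
     (\<exists>K \<in> carrier_mat (dim_col G) (dim_row G).
        poly_rank K = dim_row G \<and> G * K = 1\<^sub>m (dim_row G))"

definition control_matrix ::
  "nat \<Rightarrow> nat \<Rightarrow> 'a :: field poly vec set \<Rightarrow> 'a poly mat \<Rightarrow> bool" where
  "control_matrix n r C H \<longleftrightarrow>
     H \<in> carrier_mat n (n - r) \<and> C = {v \<in> carrier_vec n. row_mult v H = 0\<^sub>v (n - r)}"

definition coeff_vec :: "'a :: zero poly vec \<Rightarrow> nat \<Rightarrow> 'a vec" where
  "coeff_vec v i = map_vec (\<lambda>p. coeff p i) v"

text \<open>Only finitely many coefficient vectors are non-zero, so the index set below is finite.\<close>

definition conv_weight :: "'a :: zero poly vec \<Rightarrow> nat" where
  "conv_weight v =
     (\<Sum>i \<in> {i. coeff_vec v i \<noteq> 0\<^sub>v (dim_vec v)}. hamming_weight (coeff_vec v i))"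

definition free_distance :: "'a :: zero poly vec set \<Rightarrow> nat" where
  "free_distance C = Inf {conv_weight v | v. v \<in> C \<and> v \<noteq> 0\<^sub>v (dim_vec v)}"

end

theory Submission
  imports Defs
begin

text \<open>Write \<open>v = w U\<close>, so that \<open>w = v V\<close>. The codewords are exactly the vectors with
  \<open>w\<^bsub>r+j\<^esub> = z w\<^sub>j\<close> for \<open>j < n - r\<close>, and these equations are the columns of \<open>v H = 0\<close>. They force the
  lowest non-zero coefficient of \<open>v\<close> to involve only the first \<open>r\<close> rows of \<open>U\<close> and the highest one only the
  last \<open>r\<close> rows, so each has weight at least \<open>n - r + 1\<close>; if the two coincide, only \<open>2 r - n\<close>
  successive rows occur and the weight is at least \<open>2 (n - r) + 1\<close>. The lowest coefficient alone separates
  the admissible error vectors. Conversely, a generator matrix of degree \<open>\<delta> < r\<close> has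
  \<open>r - \<delta>\<close> constant rows, to which the Singleton bound applies.\<close>

subsection \<open>Rank and one-sided inverses\<close>

text \<open>Every \<open>y\<close> equals \<open>A (K y)\<close>, so the columns of \<open>A\<close>
  span the whole space.\<close>

lemma rank_eq_of_right_inverse:
  fixes A :: "'a :: field mat"
  assumes A: "A \<in> carrier_mat r n" and K: "K \<in> carrier_mat n r" and AK: "A * K = 1\<^sub>m r"
  shows "vec_space.rank r A = r"
proof -
  interpret vec_space "TYPE('a)" r .
  have "y \<in> col_space A" if y: "y \<in> carrier_vec r" for y
  proof -
    have "A *\<^sub>v (K *\<^sub>v y) = y"
      using assoc_mult_mat_vec[OF A K y] AK y by simp
    moreover have "K *\<^sub>v y \<in> carrier_vec n"
      using K y by simp
    ultimately show ?thesis
      using A y by (auto simp: col_space_eq[OF A])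
  qed
  moreover have "col_space A \<subseteq> carrier_vec r"
    using A by (auto simp: col_space_eq[OF A])
  ultimately have "span (set (cols A)) = carrier_vec r"
    by (auto simp: col_space_def)
  then show ?thesis
    using dim_is_n by (simp add: rank_def module_vec_def)
qed

text \<open>Multiplying by \<open>A\<close> recovers \<open>v\<close> from \<open>K v\<close>, so
  the kernel of \<open>K\<close> is trivial and its columns are independent.\<close>

lemma rank_eq_of_left_inverse:
  fixes K :: "'a :: field mat"
  assumes A: "A \<in> carrier_mat r n" and K: "K \<in> carrier_mat n r" and AK: "A * K = 1\<^sub>m r"
  shows "vec_space.rank n K = r"
proof -
  interpret vec_space "TYPE('a)" n .
  have inj: "v = 0\<^sub>v r" if "v \<in> carrier_vec r" "K *\<^sub>v v = 0\<^sub>v n" for v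
  proof -
    have "v = A *\<^sub>v (K *\<^sub>v v)"
      using that(1) AK by (simp flip: assoc_mult_mat_vec[OF A K that(1)])
    also have "\<dots> = 0\<^sub>v r"
      unfolding that(2) using A by (intro eq_vecI) auto
    finally show ?thesis .
  qed
  \<comment> \<open>Independence is stated for the set of columns, so repetitions must be excluded
    separately: equal columns \<open>i\<close> and \<open>j\<close> would put the difference of two
    unit vectors into the kernel.\<close>
  have dist: "distinct (cols K)"
  proof (rule ccontr)
    assume "\<not> distinct (cols K)"
    then obtain i j where ij: "i < r" "j < r" "i \<noteq> j" "col K i = col K j"
      using K by (auto simp: distinct_conv_nth)
    have "K *\<^sub>v unit_vec r k = col K k" if "k < r" for k
      using K that by (intro eq_vecI) auto
    then have "K *\<^sub>v unit_vec r i = K *\<^sub>v unit_vec r j"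
      using ij by simp
    then have "unit_vec r i - unit_vec r j = (0\<^sub>v r :: 'a vec)"
      by (intro inj) (use K in \<open>simp_all add: mult_minus_distrib_mat_vec\<close>)
    then have "(unit_vec r i - unit_vec r j :: 'a vec) $ i = 0"
      using ij by simp
    then show False using ij by simp
  qed
  have "lin_indpt (set (cols K))"
    using lin_depE[OF K _ dist] inj by metis
  then show ?thesis by (rule lin_indpt_full_rank[OF K dist])
qed

text \<open>Full rank makes the columns span, so each unit vector has the form \<open>A x\<close>.
  Moving \<open>A\<close> across the scalar product then turns \<open>u $ i\<close> into the product
  of \<open>x\<close> with the zero vector.\<close>

lemma full_row_rank_imp_left_kernel_trivial:
  fixes A :: "'a :: field mat"
  assumes A: "A \<in> carrier_mat r n" and rank: "vec_space.rank r A = r"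
    and u: "u \<in> carrier_vec r" and uA: "transpose_mat A *\<^sub>v u = 0\<^sub>v n"
  shows "u = 0\<^sub>v r"
proof -
  interpret vec_space "TYPE('a)" r .
  \<comment> \<open>The rank is the size of a maximal independent set of columns; having
    \<open>r\<close> elements, such a set is a basis.\<close>
  obtain S where S: "maximal S (\<lambda>T. T \<subseteq> set (cols A) \<and> lin_indpt T)"
    using maximal_exists[of "\<lambda>T. T \<subseteq> set (cols A) \<and> lin_indpt T" "card (set (cols A))" "{}"]
    by (meson List.finite_set card_mono empty_iff empty_subsetI finite_lin_indpt2 rev_finite_subset)
  then have S': "S \<subseteq> set (cols A)" "lin_indpt S" by (auto simp: maximal_def)
  have cols: "set (cols A) \<subseteq> carrier_vec r" using A cols_dim by blast
  have "card S = r" using rank_card_indpt[OF A S] rank by simp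
  then have "basis S"
    using S' cols by (intro dim_li_is_basis) (auto intro: finite_subset simp: dim_is_n)
  then have "carrier_vec r \<subseteq> col_space A"
    using S' span_is_monotone[of S "set (cols A)"] by (auto simp: basis_def col_space_def)
  then have ex: "\<exists>x \<in> carrier_vec n. A *\<^sub>v x = y" if "y \<in> carrier_vec r" for y
    using that A by (auto simp: col_space_eq[OF A])
  have "u $ i = 0" if i: "i < r" for i
  proof -
    obtain x where x: "x \<in> carrier_vec n" "A *\<^sub>v x = unit_vec r i"
      using ex[of "unit_vec r i"] by auto
    have "u $ i = (A *\<^sub>v x) \<bullet> u" using x u i by simp
    also have "\<dots> = x \<bullet> (transpose_mat A *\<^sub>v u)"
      using A x u transpose_vec_mult_scalar[of "transpose_mat A" n r u x] by auto
    finally show ?thesis using uA x by simp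
  qed
  then show ?thesis using u by auto
qed

text \<open>The identity \<open>G K = 1\<close> survives the embedding of polynomials into their
  fraction field, where the two rank lemmas apply.\<close>

lemma poly_rank_of_inverse:
  fixes G :: "'a :: field poly mat"
  assumes G: "G \<in> carrier_mat r n" and K: "K \<in> carrier_mat n r" and GK: "G * K = 1\<^sub>m r"
  shows "poly_rank G = r" and "poly_rank K = r"
proof -
  interpret inj_comm_ring_hom "to_fract :: 'a poly \<Rightarrow> 'a poly fract"
    by unfold_locales auto
  have "map_mat to_fract G * map_mat to_fract K = 1\<^sub>m r"
    using mat_hom_mult[OF G K] by (simp add: GK mat_hom_one)
  then have "vec_space.rank r (map_mat to_fract G) = r" "vec_space.rank n (map_mat to_fract K) = r"
    using G K by (auto intro!: rank_eq_of_right_inverse[of _ r n "map_mat to_fract K"]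
        rank_eq_of_left_inverse[of "map_mat to_fract G" r n])
  then show "poly_rank G = r" and "poly_rank K = r"
    using G K by (auto simp: poly_rank_def)
qed

section \<open>Products of a row vector with a matrix\<close>

lemma row_mult_carrier [simp]: "A \<in> carrier_mat r n \<Longrightarrow> row_mult u A \<in> carrier_vec n"
  by (simp add: row_mult_def carrier_vecI)

lemma dim_row_mult [simp]: "dim_vec (row_mult u A) = dim_col A"
  by (simp add: row_mult_def)

lemma row_mult_index:
  assumes "A \<in> carrier_mat r n" "u \<in> carrier_vec r" "j < n"
  shows "row_mult u A $ j = (\<Sum>i<r. u $ i * A $$ (i, j))"
  using assms by (auto simp: row_mult_def scalar_prod_def atLeast0LessThan mult.commute intro!: sum.cong)

lemma row_mult_assoc:
  assumes "A \<in> carrier_mat r n" "B \<in> carrier_mat n m" "u \<in> carrier_vec r"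
  shows "row_mult (row_mult u A) B = row_mult u (A * B)"
  using assms by (simp add: row_mult_def transpose_mult[of A r n B m] assoc_mult_mat_vec[of _ m n _ r])

lemma row_mult_one [simp]: "(u :: 'a :: comm_semiring_1 vec) \<in> carrier_vec n \<Longrightarrow> row_mult u (1\<^sub>m n) = u"
  by (simp add: row_mult_def)

lemma row_mult_zero [simp]: "A \<in> carrier_mat r n \<Longrightarrow> row_mult (0\<^sub>v r) A = 0\<^sub>v n"
  by (intro eq_vecI) (auto simp: row_mult_index[of _ r n])

lemma row_mult_diff:
  fixes A :: "'a :: comm_ring_1 mat"
  assumes "A \<in> carrier_mat r n" "u \<in> carrier_vec r" "v \<in> carrier_vec r"
  shows "row_mult (u - v) A = row_mult u A - row_mult v A"
  using assms by (simp add: row_mult_def mult_minus_distrib_mat_vec[of _ n r])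

text \<open>Distinct messages give distinct codewords because the rows are independent over F(z).
  This certifies that a codeword built from a non-zero message is non-zero.\<close>

lemma generator_matrix_inj:
  fixes G :: "'a :: field poly mat"
  assumes G: "generator_matrix n r G" and u: "u \<in> carrier_vec r" and uG: "row_mult u G = 0\<^sub>v n"
  shows "u = 0\<^sub>v r"
proof -
  interpret inj_comm_ring_hom "to_fract :: 'a poly \<Rightarrow> 'a poly fract"
    by unfold_locales auto
  have G': "G \<in> carrier_mat r n"
    using G by (simp add: generator_matrix_def)
  then have "poly_rank G = vec_space.rank r (map_mat to_fract G)"
    by (simp add: poly_rank_def)
  then have rank: "vec_space.rank r (map_mat to_fract G) = r"
    using G by (simp only: generator_matrix_def)
  have "(map_mat to_fract G)\<^sup>T *\<^sub>v map_vec to_fract u = map_vec to_fract (row_mult u G)"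
    using G' u by (simp add: row_mult_def mult_mat_vec_hom[of _ n r] map_mat_transpose)
  also have "\<dots> = 0\<^sub>v n"
    by (simp add: uG)
  finally have "map_vec to_fract u = 0\<^sub>v r"
    using G' u rank by (intro full_row_rank_imp_left_kernel_trivial[of "map_mat to_fract G" r n]) auto
  then show ?thesis by simp
qed

subsection \<open>Weights and a Singleton-type bound\<close>

lemma coeff_vec_carrier [simp]: "v \<in> carrier_vec n \<Longrightarrow> coeff_vec v i \<in> carrier_vec n"
  by (simp add: coeff_vec_def)

lemma coeff_vec_index [simp]: "j < dim_vec v \<Longrightarrow> coeff_vec v i $ j = coeff (v $ j) i"
  by (simp add: coeff_vec_def)

lemma finite_coeff_vec_support: "finite {i. coeff_vec v i \<noteq> 0\<^sub>v (dim_vec v)}"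
proof -
  have "{i. coeff_vec v i \<noteq> 0\<^sub>v (dim_vec v)} \<subseteq> (\<Union>j<dim_vec v. {..degree (v $ j)})"
    by (auto simp: vec_eq_iff coeff_vec_def intro: le_degree)
  then show ?thesis by (rule finite_subset) auto
qed

lemma hamming_weight_zero [simp]: "hamming_weight (0\<^sub>v n) = 0"
  by (simp add: hamming_weight_def)

lemma conv_weight_eq_sum:
  assumes "finite S" and "\<And>i. i \<notin> S \<Longrightarrow> coeff_vec v i = 0\<^sub>v (dim_vec v)"
  shows "conv_weight v = (\<Sum>i\<in>S. hamming_weight (coeff_vec v i))"
  unfolding conv_weight_def
proof (rule sum.mono_neutral_left)
  show "\<forall>i \<in> S - {i. coeff_vec v i \<noteq> 0\<^sub>v (dim_vec v)}. hamming_weight (coeff_vec v i) = 0"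
    by auto
qed (use assms in auto)

text \<open>Lower bounds on the weight can thus be read off from one or two selected
  coefficients.\<close>

lemma sum_hamming_weight_le_conv_weight:
  assumes "finite S"
  shows "(\<Sum>i\<in>S. hamming_weight (coeff_vec v i)) \<le> conv_weight v"
proof -
  let ?T = "S \<union> {i. coeff_vec v i \<noteq> 0\<^sub>v (dim_vec v)}"
  have "conv_weight v = (\<Sum>i\<in>?T. hamming_weight (coeff_vec v i))"
    using assms finite_coeff_vec_support[of v] by (intro conv_weight_eq_sum) auto
  then show ?thesis
    using assms finite_coeff_vec_support[of v] by (auto intro!: sum_mono2)
qed

text \<open>A combination of \<open>r - \<delta>\<close> constant rows can be made to vanish in the first \<open>r - \<delta> - 1\<close> positions.
  These conditions, those confining it to the chosen rows and one zero row form the square singular system \<open>M\<close>.\<close>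

lemma free_distance_le:
  fixes G :: "'a :: field poly mat"
  assumes G: "generator_matrix n r G" and deg: "conv_degree G < r" and "r \<le> n"
  shows "free_distance (conv_code G) \<le> n - r + conv_degree G + 1"
proof -
  define k where "k = r - conv_degree G"
  have k: "0 < k" "k \<le> r" using deg by (auto simp: k_def)
  have Gc: "G \<in> carrier_mat r n" using G by (simp add: generator_matrix_def)
  let ?N = "{i. i < r \<and> row_degree G i \<noteq> 0}" and ?Z = "{i. i < r \<and> row_degree G i = 0}"
  \<comment> \<open>Each non-constant row contributes at least 1 to the degree, so at most
    \<open>conv_degree G\<close> rows are non-constant and at least \<open>k\<close> are
    constant.\<close>
  have "card ?N = (\<Sum>i\<in>?N. 1)" by simp
  also have "\<dots> \<le> (\<Sum>i\<in>?N. row_degree G i)" by (intro sum_mono) auto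
  also have "\<dots> \<le> conv_degree G"
    using Gc by (auto simp: conv_degree_def intro!: sum_mono2)
  finally have "card ?N \<le> conv_degree G" .
  moreover have "card (?N \<union> ?Z) = card ?N + card ?Z"
    by (intro card_Un_disjoint) auto
  moreover have "?N \<union> ?Z = {..<r}" by auto
  ultimately have "k \<le> card ?Z" by (simp add: k_def)
  then obtain S where S: "S \<subseteq> ?Z" "card S = k" "finite S"
    by (rule obtain_subset_with_card_n)
  \<comment> \<open>The numbering \<open>g\<close> lets row \<open>i\<close> of \<open>M\<close>,
    for \<open>i\<close> in \<open>S\<close>, carry the vanishing condition at position
    \<open>g i\<close>; the number \<open>k - 1\<close> is left for the zero row.\<close>
  obtain g where g: "bij_betw g S {0..<k}"
    using ex_bij_betw_finite_nat[OF S(3)] S(2) by auto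
  define M where "M = mat r r (\<lambda>(i, j).
    if i \<notin> S then (if i = j then 1 else 0) else if g i = k - 1 then 0 else coeff (G $$ (j, g i)) 0)"
  have M: "M \<in> carrier_mat r r" by (simp add: M_def)
  have g_onto: "\<exists>i\<in>S. g i = c" if "c < k" for c
  proof -
    have "c \<in> g ` S" using bij_betw_imp_surj_on[OF g] that by simp
    then show ?thesis by blast
  qed
  obtain i0 where i0: "i0 \<in> S" "g i0 = k - 1"
    using g_onto[of "k - 1"] k by auto
  have "i0 < r" using i0 S(1) by auto
  then have "det M = (\<Sum>j<r. M $$ (i0, j) * cofactor M i0 j)"
    by (rule laplace_expansion_row[OF M])
  also have "\<dots> = 0"
    using i0 \<open>i0 < r\<close> by (intro sum.neutral) (simp add: M_def)
  finally have "det M = 0" .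
  then obtain w where w: "w \<in> carrier_vec r" "w \<noteq> 0\<^sub>v r" "M *\<^sub>v w = 0\<^sub>v r"
    using det_0_iff_vec_prod_zero_field[OF M] by auto
  have Mw: "(\<Sum>j<r. M $$ (i, j) * w $ j) = 0" if "i < r" for i
  proof -
    have "(M *\<^sub>v w) $ i = 0" using w(3) that by simp
    then show ?thesis using M w(1) that by (simp add: scalar_prod_def atLeast0LessThan)
  qed
  have w_out: "w $ i = 0" if "i < r" "i \<notin> S" for i
  proof -
    have "(\<Sum>j<r. M $$ (i, j) * w $ j) = (\<Sum>j<r. if j = i then w $ i else 0)"
      using that by (intro sum.cong) (auto simp: M_def)
    with Mw[OF that(1)] that show ?thesis by simp
  qed
  have w_eq: "(\<Sum>j<r. coeff (G $$ (j, c)) 0 * w $ j) = 0" if c: "c < k - 1" for c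
  proof -
    obtain i where i: "i \<in> S" "g i = c"
      using g_onto[of c] less_trans[OF c, of k] k by auto
    then have "i < r" using S(1) by auto
    have "(\<Sum>j<r. coeff (G $$ (j, c)) 0 * w $ j) = (\<Sum>j<r. M $$ (i, j) * w $ j)"
      using i c \<open>i < r\<close> by (intro sum.cong) (auto simp: M_def)
    with Mw[OF \<open>i < r\<close>] show ?thesis by simp
  qed
  define u where "u = map_vec (\<lambda>c. [:c:]) w"
  have u: "u \<in> carrier_vec r" "u \<noteq> 0\<^sub>v r"
    using w by (auto simp: u_def vec_eq_iff)
  define v where "v = row_mult u G"
  have v: "v \<in> carrier_vec n" using Gc by (simp add: v_def)
  have "v \<noteq> 0\<^sub>v n" using generator_matrix_inj[OF G u(1)] u(2) by (auto simp: v_def)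
  have vc: "coeff (v $ c) m = (\<Sum>i<r. w $ i * coeff (G $$ (i, c)) m)" if "c < n" for c m
  proof -
    have "coeff (v $ c) m = (\<Sum>i<r. coeff (u $ i * G $$ (i, c)) m)"
      by (simp add: v_def row_mult_index[OF Gc u(1) that] coeff_sum)
    also have "\<dots> = (\<Sum>i<r. w $ i * coeff (G $$ (i, c)) m)"
      using w(1) by (intro sum.cong) (auto simp: u_def)
    finally show ?thesis .
  qed
  \<comment> \<open>Only constant rows are combined, so the codeword is constant and its weight is
    that of a single block.\<close>
  have "coeff_vec v m = 0\<^sub>v n" if "m \<noteq> 0" for m
  proof (rule eq_vecI)
    fix c assume c: "c < dim_vec (0\<^sub>v n :: 'a vec)"
    have "w $ i * coeff (G $$ (i, c)) m = 0" if "i < r" for i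
    proof (cases "i \<in> S")
      case True
      then have "row_degree G i = 0" using S(1) by auto
      moreover have "degree (G $$ (i, c)) \<le> row_degree G i"
        using c Gc by (auto simp: row_degree_def)
      ultimately show ?thesis using \<open>m \<noteq> 0\<close> by (simp add: coeff_eq_0)
    qed (simp add: w_out that)
    then have "coeff (v $ c) m = 0"
      using c by (simp add: vc del: mult_eq_0_iff)
    then show "coeff_vec v m $ c = 0\<^sub>v n $ c"
      using c v by simp
  qed (use v in simp)
  then have "conv_weight v = (\<Sum>m\<in>{0}. hamming_weight (coeff_vec v m))"
    using v by (intro conv_weight_eq_sum) auto
  also have "\<dots> = hamming_weight (coeff_vec v 0)" by simp
  also have "\<dots> \<le> card {k - 1..<n}"
    unfolding hamming_weight_def
  proof (rule card_mono)
    have "coeff (v $ c) 0 = 0" if "c < k - 1" "c < n" for c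
      using w_eq[OF that(1)] by (simp add: vc[OF that(2)] mult.commute)
    then show "{i. i < dim_vec (coeff_vec v 0) \<and> coeff_vec v 0 $ i \<noteq> 0} \<subseteq> {k - 1..<n}"
      using v by (auto simp: coeff_vec_def not_less[symmetric])
  qed simp
  also have "\<dots> = n - r + conv_degree G + 1"
    using k deg \<open>r \<le> n\<close> by (simp add: k_def)
  finally have "conv_weight v \<le> n - r + conv_degree G + 1" .
  moreover have "free_distance (conv_code G) \<le> conv_weight v"
    unfolding free_distance_def
    using \<open>v \<noteq> 0\<^sub>v n\<close> v u Gc by (intro cInf_lower) (auto simp: conv_code_def v_def)
  ultimately show ?thesis by linarith
qed

subsection \<open>Codes spanned by successive rows\<close>

text \<open>A constant matrix acts on each coefficient separately, which reduces weights of
  codewords to weights in block codes.\<close>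

lemma coeff_vec_row_mult_const_mat:
  fixes U :: "'a :: field mat"
  assumes U: "U \<in> carrier_mat m n" and w: "w \<in> carrier_vec m"
  shows "coeff_vec (row_mult w (const_mat U)) i = row_mult (coeff_vec w i) U"
proof (rule eq_vecI)
  have U': "const_mat U \<in> carrier_mat m n" using U by simp
  fix j assume "j < dim_vec (row_mult (coeff_vec w i) U)"
  then have j: "j < n" using U by simp
  have "coeff_vec (row_mult w (const_mat U)) i $ j = (\<Sum>l<m. coeff (w $ l * const_mat U $$ (l, j)) i)"
    using U j by (simp add: row_mult_index[OF U' w j] coeff_sum)
  also have "\<dots> = (\<Sum>l<m. coeff_vec w i $ l * U $$ (l, j))"
    using U j w by (intro sum.cong) (auto simp: mult.commute)
  also have "\<dots> = row_mult (coeff_vec w i) U $ j"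
    by (rule row_mult_index[OF U _ j, symmetric]) (use w in simp)
  finally show "coeff_vec (row_mult w (const_mat U)) i $ j = row_mult (coeff_vec w i) U $ j" .
qed (simp add: coeff_vec_def)

text \<open>The weight of \<open>v\<close> is its distance to the zero word.\<close>

lemma mds_code_weight_ge:
  assumes C: "mds_code n k C" "C \<subseteq> carrier_vec n" "0\<^sub>v n \<in> C" and v: "v \<in> C" "v \<noteq> 0\<^sub>v n"
  shows "n - k + 1 \<le> hamming_weight v"
proof -
  have "dim_vec v = n" using C v by auto
  then have "hamming_dist v (0\<^sub>v n) = hamming_weight v"
    unfolding hamming_dist_def hamming_weight_def by (intro arg_cong[where f = card]) auto
  then have "hamming_weight v \<in> {hamming_dist v w | v w. v \<in> C \<and> w \<in> C \<and> v \<noteq> w}"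
    using C(3) v by (intro CollectI exI[of _ v] exI[of _ "0\<^sub>v n"]) simp
  then have "min_distance C \<le> hamming_weight v"
    unfolding min_distance_def by (intro cInf_lower) auto
  then show ?thesis using C(1) by (simp add: mds_code_def)
qed

lemma rows_code_subset:
  assumes "U \<in> carrier_mat m n"
  shows "rows_code n U i k \<subseteq> carrier_vec n" and "0\<^sub>v n \<in> rows_code n U i k"
proof -
  interpret vec_space "TYPE('a)" n .
  have rows: "row U ` {i..<i + k} \<subseteq> carrier_vec n"
    using assms by auto
  show "rows_code n U i k \<subseteq> carrier_vec n"
    using span_closed[OF rows] by (auto simp: rows_code_def)
  show "0\<^sub>v n \<in> rows_code n U i k"
    unfolding rows_code_def using vectorspace.span_zero[OF vectorspace_axioms] by simp
qed

lemma row_mult_in_rows_code: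
  fixes U :: "'a :: field mat"
  assumes U: "U \<in> carrier_mat m n" and w: "w \<in> carrier_vec m"
    and supp: "\<And>j. j < m \<Longrightarrow> w $ j \<noteq> 0 \<Longrightarrow> i \<le> j \<and> j < i + k"
  shows "row_mult w U \<in> rows_code n U i k"
proof -
  interpret vec_space "TYPE('a)" n .
  let ?R = "row U ` {i..<i + k}"
  have rows: "?R \<subseteq> carrier_vec n"
    using U by auto
  \<comment> \<open>Induction over partial sums. A row outside the window enters with coefficient 0,
    so its term stays in the span.\<close>
  have "vec n (\<lambda>l. \<Sum>j\<in>J. w $ j * U $$ (j, l)) \<in> span ?R" if "finite J" "J \<subseteq> {..<m}" for J
    using that
  proof (induction J rule: finite_induct)
    case empty
    have "vec n (\<lambda>l. 0 :: 'a) = 0\<^sub>v n" by auto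
    then show ?case using vectorspace.span_zero[OF vectorspace_axioms] by simp
  next
    case (insert x J)
    have x: "x < m" using insert by auto
    have "vec n (\<lambda>l. \<Sum>j\<in>insert x J. w $ j * U $$ (j, l)) =
        w $ x \<cdot>\<^sub>v row U x + vec n (\<lambda>l. \<Sum>j\<in>J. w $ j * U $$ (j, l))"
      using insert U x by (intro eq_vecI) auto
    moreover have "w $ x \<cdot>\<^sub>v row U x \<in> span ?R"
    proof (rule prod_in_span[OF _ rows])
      show "row U x \<in> carrier_vec n" using U by auto
      show "w $ x = 0 \<or> row U x \<in> span ?R"
      proof (cases "w $ x = 0")
        case False
        then have "row U x \<in> ?R" using supp[OF x] by simp
        then show ?thesis using span_mem[OF rows] by simp
      qed simp
    qed
    ultimately show ?case
      using insert span_add1[OF rows] by auto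
  qed
  from this[of "{..<m}"] have "vec n (\<lambda>l. \<Sum>j<m. w $ j * U $$ (j, l)) \<in> span ?R"
    by simp
  moreover have "row_mult w U = vec n (\<lambda>l. \<Sum>j<m. w $ j * U $$ (j, l))"
    using U w by (intro eq_vecI) (auto simp: row_mult_index[OF U w])
  ultimately show ?thesis by (simp add: rows_code_def)
qed

lemma hamming_weight_diff_le:
  fixes v w :: "'a :: group_add vec"
  assumes "dim_vec v = dim_vec w"
  shows "hamming_weight (v - w) \<le> hamming_weight v + hamming_weight w"
proof -
  have "hamming_weight (v - w) \<le> card ({i. i < dim_vec v \<and> v $ i \<noteq> 0} \<union> {i. i < dim_vec w \<and> w $ i \<noteq> 0})"
    unfolding hamming_weight_def using assms by (intro card_mono) auto
  also have "\<dots> \<le> hamming_weight v + hamming_weight w"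
    unfolding hamming_weight_def by (rule card_Un_le)
  finally show ?thesis .
qed

subsection \<open>The unit memory code\<close>

locale unit_memory_mds =
  fixes U V :: "'a :: field mat" and n r :: nat
  assumes r_less: "r < n" and less_2r: "n < 2 * r"
    and U: "U \<in> carrier_mat n n" and V: "V \<in> carrier_mat n n" and UV: "U * V = 1\<^sub>m n"
    and mds: "\<And>k i. 1 \<le> k \<Longrightarrow> k \<le> n \<Longrightarrow> i + k \<le> n \<Longrightarrow> mds_code n k (rows_code n U i k)"
begin

section \<open>The matrices \<open>A\<close> and \<open>H\<close>\<close>

definition A :: "'a poly mat" where
  "A = const_mat (mat_of_rows n (map (row U) [0..<r]))
     + [:0, 1:] \<cdot>\<^sub>m const_mat (mat_of_rows n (map (row U) [r..<n] @ replicate (2 * r - n) (0\<^sub>v n)))"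

definition H :: "'a poly mat" where
  "H = const_mat (mat_of_cols n (map (col V) [r..<n]))
     - [:0, 1:] \<cdot>\<^sub>m const_mat (mat_of_cols n (map (col V) [0..<n - r]))"

lemma r_pos: "0 < r"
  using r_less less_2r by simp

lemma const_U [simp]: "const_mat U \<in> carrier_mat n n" and const_V [simp]: "const_mat V \<in> carrier_mat n n"
  using U V by simp_all

lemma VU: "V * U = 1\<^sub>m n"
  by (rule mat_mult_left_right_inverse[OF U V UV])

lemma const_UV: "const_mat U * const_mat V = 1\<^sub>m n"
  and const_VU: "const_mat V * const_mat U = 1\<^sub>m n"
proof -
  interpret inj_comm_ring_hom "\<lambda>c :: 'a. [:c:]"
    by unfold_locales (auto simp: one_pCons)
  show "const_mat U * const_mat V = 1\<^sub>m n" "const_mat V * const_mat U = 1\<^sub>m n"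
    using mat_hom_mult[OF U V] mat_hom_mult[OF V U] by (simp_all add: UV VU mat_hom_one)
qed

lemma row_mult_U_V:
  assumes "w \<in> carrier_vec n"
  shows "row_mult (row_mult w (const_mat U)) (const_mat V) = w"
    and "row_mult (row_mult w (const_mat V)) (const_mat U) = w"
  using assms const_UV const_VU by (simp_all add: row_mult_assoc[OF const_U const_V] row_mult_assoc[OF const_V const_U])

lemma A_carrier [simp]: "A \<in> carrier_mat r n"
  and H_carrier [simp]: "H \<in> carrier_mat n (n - r)"
  using r_less less_2r by (auto simp: A_def H_def intro!: add_carrier_mat minus_carrier_mat)

lemma A_index:
  assumes "i < r" "j < n"
  shows "A $$ (i, j) = [:U $$ (i, j):] + (if i < n - r then pCons 0 [:U $$ (i + r, j):] else 0)"
  using assms r_less less_2r U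
  by (auto simp: A_def mat_of_rows_def nth_append add.commute)

lemma H_index:
  assumes "i < n" "j < n - r"
  shows "H $$ (i, j) = [:V $$ (i, r + j):] - pCons 0 [:V $$ (i, j):]"
  using assms r_less less_2r V
  by (auto simp: H_def mat_of_cols_def)

section \<open>Codewords in coordinates relative to the rows of \<open>U\<close>\<close>

definition shifted :: "'a poly vec \<Rightarrow> bool" where
  "shifted w \<longleftrightarrow> w \<in> carrier_vec n \<and> (\<forall>j < n - r. w $ (r + j) = pCons 0 (w $ j))"

text \<open>The only shifted vector with first \<open>r\<close> coordinates \<open>u\<close>. The
  index \<open>j - r\<close> is below \<open>n - r\<close>, hence below \<open>r\<close>, so
  \<open>u\<close> is only read inside its range.\<close>

definition extend :: "'a poly vec \<Rightarrow> 'a poly vec" where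
  "extend u = vec n (\<lambda>j. if j < r then u $ j else pCons 0 (u $ (j - r)))"

lemma shifted_extend: "shifted (extend u)"
  using r_less less_2r by (auto simp: shifted_def extend_def)

lemma extend_eq_if_shifted:
  assumes "shifted w"
  shows "extend (vec r (\<lambda>j. w $ j)) = w"
proof (rule eq_vecI)
  fix j assume "j < dim_vec w"
  then have j: "j < n" using assms by (auto simp: shifted_def)
  show "extend (vec r (\<lambda>j. w $ j)) $ j = w $ j"
  proof (cases "j < r")
    case False
    then have "w $ (r + (j - r)) = pCons 0 (w $ (j - r))"
      using assms j unfolding shifted_def by (metis diff_less_mono not_less)
    with False j less_2r show ?thesis by (simp add: extend_def)
  qed (use j in \<open>simp add: extend_def\<close>)
qed (use assms in \<open>auto simp: extend_def shifted_def\<close>)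

text \<open>In \<open>u A\<close>, row \<open>i + r\<close> of \<open>U\<close> carries the factor z
  times \<open>u $ i\<close>, which is coordinate \<open>i + r\<close> of \<open>extend u\<close>.
  The proof splits the sum over the rows of \<open>U\<close> at \<open>r\<close> and reindexes the
  upper part.\<close>

lemma row_mult_A:
  assumes u: "u \<in> carrier_vec r"
  shows "row_mult u A = row_mult (extend u) (const_mat U)"
proof (rule eq_vecI)
  fix j assume "j < dim_vec (row_mult (extend u) (const_mat U))"
  then have j: "j < n" using U by simp
  have ext: "extend u \<in> carrier_vec n" by (simp add: extend_def)
  have "row_mult (extend u) (const_mat U) $ j = (\<Sum>i<n. extend u $ i * [:U $$ (i, j):])"
    using U j by (simp add: row_mult_index[OF const_U ext j])
  also have "\<dots> = (\<Sum>i<r. extend u $ i * [:U $$ (i, j):]) + (\<Sum>i = r..<n. extend u $ i * [:U $$ (i, j):])"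
    using r_less by (simp add: lessThan_atLeast0 sum.atLeastLessThan_concat)
  also have "(\<Sum>i<r. extend u $ i * [:U $$ (i, j):]) = (\<Sum>i<r. u $ i * [:U $$ (i, j):])"
    using r_less by (intro sum.cong) (auto simp: extend_def)
  also have "(\<Sum>i = r..<n. extend u $ i * [:U $$ (i, j):]) =
      (\<Sum>i = 0..<n - r. extend u $ (i + r) * [:U $$ (i + r, j):])"
    using r_less sum.shift_bounds_nat_ivl[of "\<lambda>i. extend u $ i * [:U $$ (i, j):]" 0 r "n - r"] by simp
  also have "\<dots> = (\<Sum>i = 0..<n - r. u $ i * pCons 0 [:U $$ (i + r, j):])"
    by (intro sum.cong) (auto simp: extend_def)
  \<comment> \<open>The added zero terms match the zero rows in the coefficient of z, so that both
    sums run over the rows of \<open>A\<close>.\<close>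
  also have "\<dots> = (\<Sum>i<r. if i < n - r then u $ i * pCons 0 [:U $$ (i + r, j):] else 0)"
    using less_2r by (intro sum.mono_neutral_cong_left) auto
  also have "(\<Sum>i<r. u $ i * [:U $$ (i, j):]) + \<dots> = (\<Sum>i<r. u $ i * A $$ (i, j))"
    unfolding sum.distrib[symmetric] using j
    by (intro sum.cong) (auto simp: A_index distrib_left)
  also have "\<dots> = row_mult u A $ j"
    by (rule row_mult_index[OF A_carrier u j, symmetric])
  finally show "row_mult u A $ j = row_mult (extend u) (const_mat U) $ j" ..
qed (use U carrier_matD(2)[OF A_carrier] in simp)

lemma conv_code_A: "conv_code A = {row_mult w (const_mat U) | w. shifted w}"
proof (intro subset_antisym subsetI)
  fix v assume "v \<in> conv_code A"
  then obtain u where u: "u \<in> carrier_vec r" "v = row_mult u A"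
    using carrier_matD(1)[OF A_carrier] by (auto simp: conv_code_def)
  then show "v \<in> {row_mult w (const_mat U) | w. shifted w}"
    using shifted_extend[of u] row_mult_A[OF u(1)] by blast
next
  fix v assume "v \<in> {row_mult w (const_mat U) | w. shifted w}"
  then obtain w where w: "shifted w" "v = row_mult w (const_mat U)" by blast
  have "v = row_mult (vec r (\<lambda>j. w $ j)) A"
    using row_mult_A[of "vec r (\<lambda>j. w $ j)"] w by (simp add: extend_eq_if_shifted)
  moreover have "vec r (\<lambda>j. w $ j) \<in> carrier_vec (dim_row A)"
    using carrier_matD(1)[OF A_carrier] by simp
  ultimately show "v \<in> conv_code A"
    unfolding conv_code_def by blast
qed

text \<open>The entries of \<open>v V\<close> are the coordinates of \<open>v\<close> relative to
  the rows of \<open>U\<close>, so \<open>v H\<close> measures how far these coordinates are from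
  being shifted.\<close>

lemma row_mult_H:
  assumes v: "v \<in> carrier_vec n" and j: "j < n - r"
  shows "row_mult v H $ j = row_mult v (const_mat V) $ (r + j) - pCons 0 (row_mult v (const_mat V) $ j)"
proof -
  have pc: "pCons 0 (row_mult v (const_mat V) $ j) = (\<Sum>l<n. v $ l * pCons 0 [:V $$ (l, j):])"
  proof -
    have "pCons 0 (row_mult v (const_mat V) $ j) = [:0, 1:] * (\<Sum>l<n. v $ l * [:V $$ (l, j):])"
      using j V by (simp add: row_mult_index[OF const_V v])
    also have "\<dots> = (\<Sum>l<n. v $ l * pCons 0 [:V $$ (l, j):])"
      unfolding sum_distrib_left by (intro sum.cong) auto
    finally show ?thesis .
  qed
  have hi: "row_mult v (const_mat V) $ (r + j) = (\<Sum>l<n. v $ l * [:V $$ (l, r + j):])"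
    using j V by (simp add: row_mult_index[OF const_V v])
  have "(\<Sum>l<n. v $ l * H $$ (l, j)) = (\<Sum>l<n. v $ l * [:V $$ (l, r + j):] - v $ l * pCons 0 [:V $$ (l, j):])"
    using j by (intro sum.cong refl) (simp only: H_index right_diff_distrib lessThan_iff)
  then show ?thesis
    unfolding pc hi row_mult_index[OF H_carrier v j] sum_subtractf .
qed

lemma control_matrix_H: "control_matrix n r (conv_code A) H"
proof -
  have H_iff: "row_mult v H = 0\<^sub>v (n - r) \<longleftrightarrow> shifted (row_mult v (const_mat V))"
    if v: "v \<in> carrier_vec n" for v
  proof -
    have "row_mult v H = 0\<^sub>v (n - r) \<longleftrightarrow> (\<forall>j < n - r. row_mult v H $ j = 0)"
      using carrier_matD(2)[OF H_carrier] by (simp add: vec_eq_iff)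
    then show ?thesis
      using row_mult_carrier[OF const_V, of v] by (simp add: shifted_def row_mult_H[OF v])
  qed
  have "conv_code A = {v \<in> carrier_vec n. row_mult v H = 0\<^sub>v (n - r)}"
  proof (intro subset_antisym subsetI)
    fix v assume "v \<in> conv_code A"
    then obtain w where "shifted w" "v = row_mult w (const_mat U)"
      by (auto simp: conv_code_A)
    then show "v \<in> {v \<in> carrier_vec n. row_mult v H = 0\<^sub>v (n - r)}"
      using row_mult_carrier[OF const_U, of w] by (simp add: H_iff row_mult_U_V shifted_def)
  next
    fix v assume "v \<in> {v \<in> carrier_vec n. row_mult v H = 0\<^sub>v (n - r)}"
    then have v: "v \<in> carrier_vec n" "row_mult v H = 0\<^sub>v (n - r)" by simp_all
    then have "shifted (row_mult v (const_mat V))" by (simp only: H_iff)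
    moreover have "v = row_mult (row_mult v (const_mat V)) (const_mat U)"
      using v(1) by (rule row_mult_U_V(2)[symmetric])
    ultimately show "v \<in> conv_code A"
      unfolding conv_code_A by blast
  qed
  then show ?thesis by (simp add: control_matrix_def)
qed

section \<open>Weights of codewords and the lower bound for the free distance\<close>

lemma hamming_weight_ge:
  assumes w: "w \<in> carrier_vec n" "w \<noteq> 0\<^sub>v n" and ik: "i + k \<le> n"
    and supp: "\<And>j. j < n \<Longrightarrow> w $ j \<noteq> 0 \<Longrightarrow> i \<le> j \<and> j < i + k"
  shows "n - k + 1 \<le> hamming_weight (row_mult w U)"
proof (rule mds_code_weight_ge)
  show "mds_code n k (rows_code n U i k)"
  proof (rule mds)
    obtain j where "j < n" "w $ j \<noteq> 0"
      using w by (auto simp: vec_eq_iff)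
    then show "1 \<le> k" using supp[of j] by linarith
  qed (use ik in simp_all)
  \<comment> \<open>Multiplication by \<open>V\<close> would recover \<open>w = 0\<close>.\<close>
  show "row_mult w U \<noteq> 0\<^sub>v n"
  proof
    assume "row_mult w U = 0\<^sub>v n"
    then have "row_mult (row_mult w U) V = 0\<^sub>v n"
      using V by simp
    with w show False
      by (simp add: row_mult_assoc[OF U V] UV)
  qed
qed (use rows_code_subset[OF U] row_mult_in_rows_code[OF U w(1) supp] in auto)

lemma shifted_coeff:
  assumes "shifted w" "j < n - r"
  shows "coeff_vec w (Suc i) $ (r + j) = coeff_vec w i $ j" and "coeff_vec w 0 $ (r + j) = 0"
  using assms r_less less_2r by (auto simp: shifted_def)

text \<open>Coordinate \<open>r + j\<close> of coefficient \<open>a\<close> repeats coordinate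
  \<open>j\<close> of the preceding coefficient, which vanishes; for \<open>a = 0\<close> it is the
  constant term of a multiple of z. Only the first \<open>r\<close> rows of \<open>U\<close>
  remain.\<close>

lemma lowest_coeff_weight:
  assumes w: "shifted w" and a: "coeff_vec w a \<noteq> 0\<^sub>v n" and low: "\<And>i. i < a \<Longrightarrow> coeff_vec w i = 0\<^sub>v n"
  shows "\<And>j. r \<le> j \<Longrightarrow> j < n \<Longrightarrow> coeff_vec w a $ j = 0"
    and "n - r + 1 \<le> hamming_weight (coeff_vec (row_mult w (const_mat U)) a)"
proof -
  have wc: "w \<in> carrier_vec n" using w by (simp add: shifted_def)
  have supp: "coeff_vec w a $ j = 0" if j: "r \<le> j" "j < n" for j
  proof (cases a)
    case 0
    then show ?thesis using shifted_coeff(2)[OF w, of "j - r"] j by simp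
  next
    case (Suc b)
    then have "coeff_vec w a $ j = coeff_vec w b $ (j - r)"
      using shifted_coeff(1)[OF w, of "j - r" b] j by simp
    also have "\<dots> = 0" using low[of b] Suc j by simp
    finally show ?thesis .
  qed
  show "coeff_vec w a $ j = 0" if "r \<le> j" "j < n" for j
    using supp[OF that] .
  show "n - r + 1 \<le> hamming_weight (coeff_vec (row_mult w (const_mat U)) a)"
    unfolding coeff_vec_row_mult_const_mat[OF U wc]
    using wc a r_less supp by (intro hamming_weight_ge[of _ 0 r]) (auto simp: not_less[symmetric])
qed

lemma shifted_lowest:
  assumes w: "shifted w" and "w \<noteq> 0\<^sub>v n"
  obtains a where "coeff_vec w a \<noteq> 0\<^sub>v n" "\<And>i. i < a \<Longrightarrow> coeff_vec w i = 0\<^sub>v n"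
proof -
  have wc: "w \<in> carrier_vec n" using w by (simp add: shifted_def)
  obtain j where j: "j < n" "w $ j \<noteq> 0" using assms wc by (auto simp: vec_eq_iff)
  then obtain i where "coeff (w $ j) i \<noteq> 0" by (auto simp: poly_eq_iff)
  then have "coeff_vec w i \<noteq> 0\<^sub>v n"
    using j wc by (auto simp: vec_eq_iff)
  then show thesis
    using that[of "LEAST i. coeff_vec w i \<noteq> 0\<^sub>v n"]
    by (metis (mono_tags, lifting) LeastI not_less_Least)
qed

lemma conv_weight_ge:
  assumes w: "shifted w" and "w \<noteq> 0\<^sub>v n"
  shows "2 * (n - r) + 1 \<le> conv_weight (row_mult w (const_mat U))" (is "_ \<le> conv_weight ?v")
proof -
  have wc: "w \<in> carrier_vec n" using w by (simp add: shifted_def)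
  obtain a where a: "coeff_vec w a \<noteq> 0\<^sub>v n" "\<And>i. i < a \<Longrightarrow> coeff_vec w i = 0\<^sub>v n"
    using shifted_lowest[OF assms] by blast
  define P where "P = {i. coeff_vec w i \<noteq> 0\<^sub>v n}"
  have P: "finite P" "a \<in> P"
    using finite_coeff_vec_support[of w] wc a by (auto simp: P_def)
  define b where "b = Max P"
  have b: "coeff_vec w b \<noteq> 0\<^sub>v n" "coeff_vec w (Suc b) = 0\<^sub>v n" "a \<le> b"
  proof -
    have "b \<in> P" unfolding b_def using P by (intro Max_in) auto
    moreover have "Suc b \<notin> P" using Max_ge[OF P(1), of "Suc b"] by (auto simp: b_def)
    ultimately show "coeff_vec w b \<noteq> 0\<^sub>v n" "coeff_vec w (Suc b) = 0\<^sub>v n"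
      by (simp_all add: P_def)
    show "a \<le> b" unfolding b_def using P by (intro Max_ge)
  qed
  \<comment> \<open>Mirror image of the lowest coefficient: the first \<open>n - r\<close>
    coordinates at \<open>b\<close> reappear as the last ones at \<open>Suc b\<close>, where
    everything is zero.\<close>
  have high: "coeff_vec w b $ j = 0" if "j < n - r" for j
    using shifted_coeff(1)[OF w that, of b] b(2) that by simp
  note low = lowest_coeff_weight[OF w a]
  show ?thesis
  proof (cases "a = b")
    \<comment> \<open>Both restrictions hold at once, leaving the \<open>2 * r - n\<close> rows from
      \<open>n - r\<close> to \<open>r - 1\<close>; the mds bound is then exactly
      \<open>2 * (n - r) + 1\<close>.\<close>
    case True
    have "n - (2 * r - n) + 1 \<le> hamming_weight (coeff_vec ?v a)"
      unfolding coeff_vec_row_mult_const_mat[OF U wc]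
    proof (rule hamming_weight_ge[of _ "n - r"])
      fix j assume "j < n" "coeff_vec w a $ j \<noteq> 0"
      then have "\<not> r \<le> j" "\<not> j < n - r" using low(1) high True by auto
      then show "n - r \<le> j \<and> j < n - r + (2 * r - n)" using r_less less_2r by auto
    qed (use wc a r_less less_2r in auto)
    also have "\<dots> \<le> conv_weight ?v"
      using sum_hamming_weight_le_conv_weight[of "{a}" ?v] by simp
    finally show ?thesis using r_less less_2r by linarith
  next
    \<comment> \<open>Two different coefficients each contribute at least \<open>n - r + 1\<close>,
      one more in total than required.\<close>
    case False
    have "n - r + 1 \<le> hamming_weight (coeff_vec ?v b)"
      unfolding coeff_vec_row_mult_const_mat[OF U wc]
    proof (rule hamming_weight_ge[of _ "n - r"])
      fix j assume "j < n" "coeff_vec w b $ j \<noteq> 0"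
      then show "n - r \<le> j \<and> j < n - r + r" using high[of j] r_less by (auto simp: not_less[symmetric])
    qed (use wc b r_less in auto)
    moreover have "hamming_weight (coeff_vec ?v a) + hamming_weight (coeff_vec ?v b) \<le> conv_weight ?v"
      using sum_hamming_weight_le_conv_weight[of "{a, b}" ?v] False by simp
    ultimately show ?thesis using low(2) by linarith
  qed
qed

lemma row_mult_U_eq_0_iff:
  assumes "w \<in> carrier_vec n"
  shows "row_mult w (const_mat U) = 0\<^sub>v n \<longleftrightarrow> w = 0\<^sub>v n"
  using row_mult_U_V(1)[OF assms] row_mult_zero[OF const_U] row_mult_zero[OF const_V] by metis

lemma free_distance_ge: "2 * (n - r) + 1 \<le> free_distance (conv_code A)"
  unfolding free_distance_def
proof (rule cInf_greatest)
  \<comment> \<open>The greatest-lower-bound rule needs a non-zero codeword. Position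
    \<open>n - r\<close> lies outside both the first and the last \<open>n - r\<close> positions, so
    every shift equation reads 0 = 0.\<close>
  define w where "w = (unit_vec n (n - r) :: 'a poly vec)"
  have "shifted w" "w \<noteq> 0\<^sub>v n"
    using r_less less_2r by (auto simp: w_def shifted_def)
  then show "{conv_weight v | v. v \<in> conv_code A \<and> v \<noteq> 0\<^sub>v (dim_vec v)} \<noteq> {}"
    using row_mult_U_eq_0_iff[of w] U by (auto simp: conv_code_A shifted_def)
next
  fix x assume "x \<in> {conv_weight v | v. v \<in> conv_code A \<and> v \<noteq> 0\<^sub>v (dim_vec v)}"
  then show "2 * (n - r) + 1 \<le> x"
    unfolding conv_code_A using conv_weight_ge row_mult_zero[OF const_U] U by fastforce
qed

section \<open>Right inverse, degree and memory of \<open>A\<close>\<close>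

lemma right_inverse_A:
  defines "K \<equiv> mat n r (\<lambda>(l, j). [:V $$ (l, j):])"
  shows "K \<in> carrier_mat n r" and "A * K = 1\<^sub>m r"
proof -
  show K: "K \<in> carrier_mat n r" by (simp add: K_def)
  have UV': "(\<Sum>l<n. U $$ (i, l) * V $$ (l, j)) = (if i = j then 1 else 0)" if "i < n" "j < n" for i j
  proof -
    have "(U * V) $$ (i, j) = (\<Sum>l<n. U $$ (i, l) * V $$ (l, j))"
      using U V that by (simp add: scalar_prod_def lessThan_atLeast0)
    then show ?thesis using that by (simp add: UV)
  qed
  have sum_const_poly: "(\<Sum>l<n. [:f l:]) = [:\<Sum>l<n. f l:]"
    and sum_linear_poly: "(\<Sum>l<n. pCons 0 [:f l:]) = pCons 0 [:\<Sum>l<n. f l:]" for f :: "nat \<Rightarrow> 'a"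
    by (auto simp: poly_eq_iff coeff_sum coeff_pCons split: nat.splits)
  show "A * K = 1\<^sub>m r"
  proof (rule eq_matI)
    fix i j assume "i < dim_row (1\<^sub>m r :: 'a poly mat)" "j < dim_col (1\<^sub>m r :: 'a poly mat)"
    then have ij: "i < r" "j < r" by simp_all
    have "(A * K) $$ (i, j) = (\<Sum>l<n. A $$ (i, l) * K $$ (l, j))"
      using ij K A_carrier by (simp add: scalar_prod_def lessThan_atLeast0 del: A_carrier)
    also have "\<dots> = (\<Sum>l<n. [:U $$ (i, l) * V $$ (l, j):] +
        (if i < n - r then pCons 0 [:U $$ (i + r, l) * V $$ (l, j):] else 0))"
      using ij by (intro sum.cong) (auto simp: A_index K_def mult.commute)
    also have "\<dots> = [:\<Sum>l<n. U $$ (i, l) * V $$ (l, j):] +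
        (if i < n - r then pCons 0 [:\<Sum>l<n. U $$ (i + r, l) * V $$ (l, j):] else 0)"
      by (simp add: sum.distrib sum_const_poly sum_linear_poly)
    \<comment> \<open>\<open>K\<close> consists of the first \<open>r\<close> columns of
      \<open>V\<close>. The coefficient of z pairs row \<open>i + r\<close> of \<open>U\<close> with
      column \<open>j < r\<close> of \<open>V\<close>, an off-diagonal entry of \<open>U V\<close>,
      and so vanishes.\<close>
    also have "\<dots> = 1\<^sub>m r $$ (i, j)"
      using ij r_less UV'[of i j] UV'[of "i + r" j] by (auto simp: one_pCons)
    finally show "(A * K) $$ (i, j) = 1\<^sub>m r $$ (i, j)" .
  qed (use K carrier_matD[OF A_carrier] in simp_all)
qed

lemma generator_matrix_A: "generator_matrix n r A"
  using poly_rank_of_inverse(1)[OF A_carrier right_inverse_A] A_carrier by (simp add: generator_matrix_def)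

lemma noncatastrophic_A: "noncatastrophic A"
  using right_inverse_A poly_rank_of_inverse(2)[OF A_carrier right_inverse_A] carrier_matD[OF A_carrier]
  by (auto simp: noncatastrophic_def)

lemma row_degree_A:
  assumes i: "i < r"
  shows "row_degree A i = (if i < n - r then 1 else 0)"
proof (cases "i < n - r")
  case True
  have deg: "degree (A $$ (i, j)) = (if U $$ (i + r, j) = 0 then 0 else 1)" if "j < n" for j
    using True i that by (simp add: A_index)
  \<comment> \<open>A zero row of \<open>U\<close> would contradict the diagonal of
    \<open>U V = 1\<close>.\<close>
  have "\<exists>j<n. U $$ (i + r, j) \<noteq> 0"
  proof (rule ccontr)
    assume "\<not> ?thesis"
    then have "(U * V) $$ (i + r, i + r) = 0"
      using U V True by (simp add: scalar_prod_def)
    then show False using True by (simp add: UV)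
  qed
  then obtain j where "j < n" "U $$ (i + r, j) \<noteq> 0" by auto
  then have "1 \<in> (\<lambda>j. degree (A $$ (i, j))) ` {..<n}"
    using deg[of j] by (intro image_eqI[of _ _ j]) auto
  then have "Max ((\<lambda>j. degree (A $$ (i, j))) ` {..<n}) = 1"
    using deg by (intro Max_eqI) auto
  then show ?thesis using True carrier_matD[OF A_carrier] by (simp add: row_degree_def)
next
  case False
  have "(\<lambda>j. degree (A $$ (i, j))) ` {..<n} = {0}"
    using False i r_less by (auto simp: A_index image_iff intro!: exI[of _ 0])
  then show ?thesis using False carrier_matD[OF A_carrier] by (simp add: row_degree_def)
qed

lemma conv_degree_A: "conv_degree A = n - r"
proof -
  have "conv_degree A = (\<Sum>i<r. if i < n - r then 1 else 0)"
    using carrier_matD[OF A_carrier] by (simp add: conv_degree_def row_degree_A)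
  also have "\<dots> = (\<Sum>i<n - r. 1)"
    using less_2r by (intro sum.mono_neutral_cong_right) auto
  finally show ?thesis by simp
qed

lemma conv_memory_A: "conv_memory A = 1"
  unfolding conv_memory_def
proof (rule Max_eqI)
  show "1 \<in> row_degree A ` {..<dim_row A}"
    using r_pos r_less row_degree_A[of 0] carrier_matD[OF A_carrier]
    by (intro image_eqI[of _ _ 0]) auto
qed (use carrier_matD[OF A_carrier] in \<open>auto simp: row_degree_A\<close>)

text \<open>The degree \<open>n - r\<close> is below \<open>r\<close>, so the Singleton-type bound
  applies to \<open>A\<close> and meets the lower bound.\<close>

lemma free_distance_A: "free_distance (conv_code A) = 2 * (n - r) + 1"
proof (rule antisym)
  show "free_distance (conv_code A) \<le> 2 * (n - r) + 1"
    using free_distance_le[OF generator_matrix_A, unfolded conv_degree_A] r_less less_2r by linarith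
qed (rule free_distance_ge)

text \<open>The difference of two errors with equal syndrome is a codeword. If non-zero, its lowest
  coefficient has weight at least \<open>n - r + 1\<close>, but two admissible errors differ in at
  most \<open>n - r\<close> places at each coefficient.\<close>

lemma error_unique:
  assumes E: "E \<in> carrier_vec n" "E' \<in> carrier_vec n"
    and wt: "\<And>i. hamming_weight (coeff_vec E i) \<le> (n - r) div 2"
      "\<And>i. hamming_weight (coeff_vec E' i) \<le> (n - r) div 2"
    and eq: "row_mult E H = row_mult E' H"
  shows "E = E'"
proof -
  have "row_mult (E - E') H = 0\<^sub>v (n - r)"
    using eq row_mult_carrier[OF H_carrier, of E'] by (simp add: row_mult_diff[OF H_carrier E])
  then have "E - E' \<in> conv_code A"
    using control_matrix_H E by (auto simp: control_matrix_def)
  then obtain w where w: "shifted w" "E - E' = row_mult w (const_mat U)"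
    by (auto simp: conv_code_A)
  have "w = 0\<^sub>v n"
  proof (rule ccontr)
    assume "w \<noteq> 0\<^sub>v n"
    then obtain a where a: "coeff_vec w a \<noteq> 0\<^sub>v n" "\<And>i. i < a \<Longrightarrow> coeff_vec w i = 0\<^sub>v n"
      using shifted_lowest[OF w(1)] by blast
    have "n - r + 1 \<le> hamming_weight (coeff_vec (E - E') a)"
      unfolding w(2) by (rule lowest_coeff_weight(2)[OF w(1) a])
    also have "coeff_vec (E - E') a = coeff_vec E a - coeff_vec E' a"
      using E by (intro eq_vecI) (auto simp: coeff_vec_def)
    also have "hamming_weight \<dots> \<le> hamming_weight (coeff_vec E a) + hamming_weight (coeff_vec E' a)"
      using E by (intro hamming_weight_diff_le) (simp add: coeff_vec_def)
    also have "\<dots> \<le> (n - r) div 2 + (n - r) div 2"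
      using wt by (intro add_mono)
    finally show False by linarith
  qed
  then have diff: "E - E' = 0\<^sub>v n" using w(2) row_mult_zero[OF const_U] by simp
  have "E $ i = E' $ i" if "i < n" for i
    using arg_cong[OF diff, of "\<lambda>v. v $ i"] that E by simp
  then show ?thesis using E by (intro eq_vecI) auto
qed

end

theorem mainTheorem1:
  fixes U V :: "'a :: field mat" and n r :: nat
    and A H :: "'a poly mat" and C :: "'a poly vec set"
  assumes "0 < r" and "r < n" and "n < 2 * r"
    and "U \<in> carrier_mat n n" and "V \<in> carrier_mat n n" and "U * V = 1\<^sub>m n"
    and mds: "\<And>k i. 1 \<le> k \<Longrightarrow> k \<le> n \<Longrightarrow> i + k \<le> n \<Longrightarrow> mds_code n k (rows_code n U i k)"
    and A: "A = const_mat (mat_of_rows n (map (row U) [0..<r]))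
              + [:0, 1:] \<cdot>\<^sub>m const_mat (mat_of_rows n
                    (map (row U) [r..<n] @ replicate (2 * r - n) (0\<^sub>v n)))"
    and H: "H = const_mat (mat_of_cols n (map (col V) [r..<n]))
              - [:0, 1:] \<cdot>\<^sub>m const_mat (mat_of_cols n (map (col V) [0..<n - r]))"
    and C: "C = conv_code A"
  shows "(generator_matrix n r A \<and> noncatastrophic A \<and> conv_rate A = of_nat r / of_nat n \<and>
            conv_memory A = 1 \<and> conv_degree A = n - r)
       \<and> control_matrix n r C H
       \<and> (free_distance C = 2 * (n - r) + 1 \<and>
          (\<forall>G :: 'a poly mat. generator_matrix n r G \<and> conv_degree G = n - r
             \<longrightarrow> free_distance (conv_code G) \<le> free_distance C) \<and>
          (let \<delta> = n - r in free_distance C = (n - r) * (\<delta> div r + 1) + \<delta> + 1))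
       \<and> (\<forall>E E' :: 'a poly vec. E \<in> carrier_vec n \<longrightarrow> E' \<in> carrier_vec n \<longrightarrow>
            (\<forall>i. hamming_weight (coeff_vec E i) \<le> (n - r) div 2) \<longrightarrow>
            (\<forall>i. hamming_weight (coeff_vec E' i) \<le> (n - r) div 2) \<longrightarrow>
            row_mult E H = row_mult E' H \<longrightarrow> E = E')"
proof -
  interpret M: unit_memory_mds U V n r
    using assms(2-6) mds by unfold_locales
  have AH: "A = M.A" "H = M.H"
    using A H by (simp_all only: M.A_def M.H_def)
  have "conv_rate A = of_nat r / of_nat n"
    using carrier_matD[OF M.A_carrier] by (simp add: AH conv_rate_def)
  \<comment> \<open>Optimality: the bound holds for every generator matrix of the same
    degree.\<close>
  moreover have "free_distance (conv_code G) \<le> 2 * (n - r) + 1"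
    if "generator_matrix n r G" "conv_degree G = n - r" for G :: "'a poly mat"
    using free_distance_le[OF that(1)] that(2) assms(2,3) by linarith
  \<comment> \<open>With this quotient zero, the general formula collapses to
    \<open>2 * (n - r) + 1\<close>.\<close>
  moreover have "(n - r) div r = 0"
    using assms(2,3) by simp
  ultimately show ?thesis
    using M.generator_matrix_A M.noncatastrophic_A M.conv_memory_A M.conv_degree_A
      M.control_matrix_H M.free_distance_A M.error_unique
    unfolding C AH Let_def by auto
qed

end
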